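(* Let $v,d\ge0$, let $\varphi\in\mathbf{K}[v,d]$ and let $\omega$ be a prime orbit of $\mathbf{K}[v,d]$. If $[\varphi]$ contains some but not all minterms of $\omega$ (i.e. $\emptyset\ne[\varphi]\cap\omega\subsetneq\omega$), then there is a prime substitution $\varsigma\in\mathcal{S}_p(v,0)$ such that $[\varphi\wedge(\varphi\circ\varsigma)]\subsetneq[\varphi]$ (i.e. $[\varphi]\not\subseteq[\varphi\circ\varsigma]$).
   Context: Formulas are unimodal propositional formulas in variables $p_0,\dots,p_{v-1}$; $\mathbf{K}$ is the least normal modal logic. $\mathbf{K}[v,d]$ is the Lindenbaum–Tarski algebra of formulas in $p_0,\dots,p_{v-1}$ of modal degree $\le d$ modulo $\mathbf{K}$-equivalence; it is a finite Boolean algebra whose atoms (minterms) are: level 0: the $2^v$ conjunctions $\bigwedge_i\pm p_i$; level $d+1$: all $m\wedge\bigwedge_\mu\pm\Diamond\mu$ with $m$ a level-0 minterm and $\mu$ ranging over all level-$d$ minterms. Each $\varphi\in\mathbf{K}[v,d]$ is identified with its set $[\varphi]$ of minterms. A level-0 substitution is a tuple $(\sigma_0,\dots,\sigma_{v-1})$ of classical propositional formulas in $p_0,\dots,p_{v-1}$, acting by $\varphi\circ\sigma=\varphi(\sigma_0,\dots,\sigma_{v-1})$; with composition $(\sigma\sigma')_i=\sigma_i(\sigma'_0,\dots,\sigma'_{v-1})$ these form a monoid, whose group of invertible elements is $\mathcal{S}_p(v,0)$ (prime substitutions). Each prime substitution permutes the level-$d$ minterms via $\mu\mapsto\mu\circ\varsigma$,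 giving a group action of $\mathcal{S}_p(v,0)$ on the set of level-$d$ minterms; its orbits are called the prime orbits of $\mathbf{K}[v,d]$. *)

theory Defs
  imports "HOL-Algebra.Group_Action"
begin

datatype fm = Var nat | Fls | Imp fm fm | Box fm

abbreviation Neg :: "fm \<Rightarrow> fm" where "Neg A \<equiv> Imp A Fls"
abbreviation Tru :: fm where "Tru \<equiv> Neg Fls"
abbreviation Or :: "fm \<Rightarrow> fm \<Rightarrow> fm" where "Or A B \<equiv> Imp (Neg A) B"
abbreviation And :: "fm \<Rightarrow> fm \<Rightarrow> fm" where "And A B \<equiv> Neg (Imp A (Neg B))"
abbreviation Dia :: "fm \<Rightarrow> fm" where "Dia A \<equiv> Neg (Box (Neg A))"

fun fvars :: "fm \<Rightarrow> nat set" where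
  "fvars (Var i) = {i}"
| "fvars Fls = {}"
| "fvars (Imp A B) = fvars A \<union> fvars B"
| "fvars (Box A) = fvars A"

fun mdeg :: "fm \<Rightarrow> nat" where
  "mdeg (Var i) = 0"
| "mdeg Fls = 0"
| "mdeg (Imp A B) = max (mdeg A) (mdeg B)"
| "mdeg (Box A) = Suc (mdeg A)"

fun fsubst :: "(nat \<Rightarrow> fm) \<Rightarrow> fm \<Rightarrow> fm" where
  "fsubst s (Var i) = s i"
| "fsubst s Fls = Fls"
| "fsubst s (Imp A B) = Imp (fsubst s A) (fsubst s B)"
| "fsubst s (Box A) = Box (fsubst s A)"

text \<open>Classical truth values, where variables and boxed formulas are treated as atoms.\<close>

fun tval :: "(fm \<Rightarrow> bool) \<Rightarrow> fm \<Rightarrow> bool" where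
  "tval h (Var i) = h (Var i)"
| "tval h Fls = False"
| "tval h (Imp A B) = (tval h A \<longrightarrow> tval h B)"
| "tval h (Box A) = h (Box A)"

definition tautology :: "fm \<Rightarrow> bool" where
  "tautology A \<longleftrightarrow> (\<forall>h. tval h A)"

inductive K_thm :: "fm \<Rightarrow> bool" where
  taut: "tautology A \<Longrightarrow> K_thm A"
| K: "K_thm (Imp (Box (Imp A B)) (Imp (Box A) (Box B)))"
| MP: "K_thm (Imp A B) \<Longrightarrow> K_thm A \<Longrightarrow> K_thm B"
| Nec: "K_thm A \<Longrightarrow> K_thm (Box A)"
| Subst: "K_thm A \<Longrightarrow> K_thm (fsubst s A)"

definition K_equiv :: "fm \<Rightarrow> fm \<Rightarrow> bool" where
  "K_equiv A B \<longleftrightarrow> K_thm (Imp A B) \<and> K_thm (Imp B A)"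

lemma K_taut1: "K_thm A \<Longrightarrow> tautology (Imp A B) \<Longrightarrow> K_thm B"
  by (blast intro: K_thm.MP K_thm.taut)

lemma K_taut2: "K_thm A \<Longrightarrow> K_thm B \<Longrightarrow> tautology (Imp A (Imp B C)) \<Longrightarrow> K_thm C"
  by (blast intro: K_thm.MP K_thm.taut)

lemma K_Imp_refl: "K_thm (Imp A A)"
  by (rule K_thm.taut) (simp add: tautology_def)

lemma K_Imp_trans: "K_thm (Imp A B) \<Longrightarrow> K_thm (Imp B C) \<Longrightarrow> K_thm (Imp A C)"
  by (erule (1) K_taut2) (simp add: tautology_def)

lemma K_Imp_mono: "K_thm (Imp A' A) \<Longrightarrow> K_thm (Imp B B') \<Longrightarrow> K_thm (Imp (Imp A B) (Imp A' B'))"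
  by (erule (1) K_taut2) (simp add: tautology_def)

lemma K_Box_mono: "K_thm (Imp A B) \<Longrightarrow> K_thm (Imp (Box A) (Box B))"
  by (blast intro: K_thm.MP K_thm.K K_thm.Nec)

lemma K_equiv_Imp: "K_equiv A A' \<Longrightarrow> K_equiv B B' \<Longrightarrow> K_equiv (Imp A B) (Imp A' B')"
  by (simp add: K_equiv_def K_Imp_mono)

lemma K_equiv_Box: "K_equiv A B \<Longrightarrow> K_equiv (Box A) (Box B)"
  by (simp add: K_equiv_def K_Box_mono)

lemma K_equiv_refl: "K_equiv A A"
  by (simp add: K_equiv_def K_Imp_refl)

lemma equivp_K_equiv: "equivp K_equiv"
  by (rule equivpI) (auto simp: reflp_def symp_def transp_def K_equiv_def
      intro: K_Imp_refl K_Imp_trans)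

lemma K_equiv_fsubst:
  assumes "\<And>i. K_equiv (s i) (t i)" and "K_equiv A B"
  shows "K_equiv (fsubst s A) (fsubst t B)"
proof -
  have 1: "K_equiv (fsubst s A) (fsubst t A)"
    by (induction A) (auto simp: assms(1) K_equiv_refl K_equiv_Imp K_equiv_Box)
  have 2: "K_equiv (fsubst t A) (fsubst t B)"
    using assms(2) K_thm.Subst[of _ t] unfolding K_equiv_def by force
  show ?thesis
    using 1 2 equivp_transp[OF equivp_K_equiv] by blast
qed

text \<open>
  Elements of \<open>kform\<close> are the \<open>K\<close>-equivalence classes of formulas in all variables
  \<open>p\<^sub>0, p\<^sub>1, \<dots>\<close>; the algebra \<open>K[v,d]\<close> is the subset \<open>K_alg v d\<close> below.
\<close>

quotient_type kform = fm / K_equiv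
  by (rule equivp_K_equiv)

instantiation kform :: boolean_algebra
begin

lift_definition bot_kform :: kform is Fls .
lift_definition top_kform :: kform is Tru .

lift_definition uminus_kform :: "kform \<Rightarrow> kform" is Neg
  by (simp add: K_equiv_Imp K_equiv_refl)

lift_definition inf_kform :: "kform \<Rightarrow> kform \<Rightarrow> kform" is And
  by (simp add: K_equiv_Imp K_equiv_refl)

lift_definition sup_kform :: "kform \<Rightarrow> kform \<Rightarrow> kform" is Or
  by (simp add: K_equiv_Imp K_equiv_refl)

lift_definition minus_kform :: "kform \<Rightarrow> kform \<Rightarrow> kform" is "\<lambda>A B. And A (Neg B)"
  by (simp add: K_equiv_Imp K_equiv_refl)

lift_definition less_eq_kform :: "kform \<Rightarrow> kform \<Rightarrow> bool" is "\<lambda>A B. K_thm (Imp A B)"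
  unfolding K_equiv_def by (blast intro: K_Imp_trans)

definition less_kform :: "kform \<Rightarrow> kform \<Rightarrow> bool" where
  "less_kform x y \<longleftrightarrow> x \<le> y \<and> \<not> y \<le> x"

instance
proof
  fix x y z :: kform
  show "(x < y) = (x \<le> y \<and> \<not> y \<le> x)" by (rule less_kform_def)
  show "x \<le> x" by transfer (rule K_Imp_refl)
  show "x \<le> y \<Longrightarrow> y \<le> z \<Longrightarrow> x \<le> z" by transfer (rule K_Imp_trans)
  show "x \<le> y \<Longrightarrow> y \<le> x \<Longrightarrow> x = y" by transfer (simp add: K_equiv_def)
  show "inf x y \<le> x" by transfer (rule K_thm.taut, simp add: tautology_def)
  show "inf x y \<le> y" by transfer (rule K_thm.taut, simp add: tautology_def)
  show "x \<le> y \<Longrightarrow> x \<le> z \<Longrightarrow> x \<le> inf y z"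
    by transfer (erule (1) K_taut2, simp add: tautology_def)
  show "x \<le> sup x y" by transfer (rule K_thm.taut, simp add: tautology_def)
  show "y \<le> sup x y" by transfer (rule K_thm.taut, simp add: tautology_def)
  show "y \<le> x \<Longrightarrow> z \<le> x \<Longrightarrow> sup y z \<le> x"
    by transfer (erule (1) K_taut2, auto simp add: tautology_def)
  show "bot \<le> x" by transfer (rule K_thm.taut, simp add: tautology_def)
  show "x \<le> top_class.top" by transfer (rule K_thm.taut, simp add: tautology_def)
  show "sup x (inf y z) = inf (sup x y) (sup x z)"
    by transfer (auto simp add: tautology_def K_equiv_def intro!: K_thm.taut)
  show "inf x (- x) = bot"
    by transfer (auto simp add: tautology_def K_equiv_def intro!: K_thm.taut)
  show "sup x (- x) = top_class.top"
    by transfer (auto simp add: tautology_def K_equiv_def intro!: K_thm.taut)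
  show "x - y = inf x (- y)" by transfer (rule K_equiv_refl)
qed

end

lift_definition kvar :: "nat \<Rightarrow> kform" is Var .

lift_definition kdia :: "kform \<Rightarrow> kform" is Dia
  by (simp add: K_equiv_Imp K_equiv_Box K_equiv_refl)

lift_definition ksubst :: "(nat \<Rightarrow> kform) \<Rightarrow> kform \<Rightarrow> kform" is fsubst
  by (simp add: K_equiv_fsubst rel_fun_def)

definition K_alg :: "nat \<Rightarrow> nat \<Rightarrow> kform set" where
  "K_alg v d = abs_kform ` {A. fvars A \<subseteq> {..<v} \<and> mdeg A \<le> d}"

text \<open>The meet of a finite set; the empty meet is \<open>top\<close>.\<close>

definition meet :: "kform set \<Rightarrow> kform" where
  "meet X = Finite_Set.fold inf top_class.top X"

text \<open>A choice of signs is given by the set of indices with positive sign.\<close>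

definition minterms0 :: "nat \<Rightarrow> kform set" where
  "minterms0 v =
    {meet ((\<lambda>i. if i \<in> S then kvar i else - kvar i) ` {..<v}) | S. S \<subseteq> {..<v}}"

fun minterms :: "nat \<Rightarrow> nat \<Rightarrow> kform set" where
  "minterms v 0 = minterms0 v"
| "minterms v (Suc d) =
    {inf m (meet ((\<lambda>\<mu>. if \<mu> \<in> T then kdia \<mu> else - kdia \<mu>) ` minterms v d)) | m T.
       m \<in> minterms0 v \<and> T \<subseteq> minterms v d}"

definition minterms_of :: "nat \<Rightarrow> nat \<Rightarrow> kform \<Rightarrow> kform set" where
  "minterms_of v d x = {\<mu> \<in> minterms v d. \<mu> \<le> x}"

text \<open>
  The components of a level-0 substitution are taken up to equivalence, as elements of
  \<open>K[v,0]\<close>. Tuples are extensional functions on \<open>{..<v}\<close>; their values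
  elsewhere do not affect how they act on \<open>K[v,d]\<close>.
\<close>

definition subst0_monoid :: "nat \<Rightarrow> (nat \<Rightarrow> kform) monoid" where
  "subst0_monoid v =
    \<lparr>carrier = {..<v} \<rightarrow>\<^sub>E K_alg v 0,
     mult = (\<lambda>s t. \<lambda>i\<in>{..<v}. ksubst t (s i)),
     one = (\<lambda>i\<in>{..<v}. kvar i)\<rparr>"

definition prime_substs :: "nat \<Rightarrow> (nat \<Rightarrow> kform) monoid" where
  "prime_substs v = units_of (subst0_monoid v)"

text \<open>
  With the composition above this is a right action:
  \<open>ksubst (s \<otimes> t) x = ksubst t (ksubst s x)\<close> for \<open>x\<close> in \<open>K[v,d]\<close>.
\<close>

definition prime_orbits :: "nat \<Rightarrow> nat \<Rightarrow> kform set set" where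
  "prime_orbits v d = orbits (prime_substs v) (minterms v d) ksubst"

lemma fsubst_cong: "(\<And>i. i \<in> fvars A \<Longrightarrow> s i = t i) \<Longrightarrow> fsubst s A = fsubst t A"
  by (induction A) auto

lemma fsubst_fsubst: "fsubst t (fsubst s A) = fsubst (\<lambda>i. fsubst t (s i)) A"
  by (induction A) auto

lemma fsubst_Var: "fsubst Var A = A"
  by (induction A) auto

lemma fvars_fsubst: "fvars (fsubst s A) = (\<Union>i\<in>fvars A. fvars (s i))"
  by (induction A) auto

lemma mdeg_fsubst: "(\<And>i. i \<in> fvars A \<Longrightarrow> mdeg (s i) = 0) \<Longrightarrow> mdeg (fsubst s A) = mdeg A"
  by (induction A) auto

lemma ksubst_abs: "ksubst (\<lambda>i. abs_kform (s i)) (abs_kform A) = abs_kform (fsubst s A)"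
proof -
  have "\<And>s y A. (\<And>i. abs_kform (s i) = y i) \<Longrightarrow> abs_kform (fsubst s A) = ksubst y (abs_kform A)"
    using ksubst.transfer by (simp add: rel_fun_def kform.pcr_cr_eq cr_kform_def)
  from this[of s "\<lambda>i. abs_kform (s i)" A] show ?thesis
    by simp
qed

lemma ksubst_cong:
  assumes "x \<in> K_alg v d" and "\<And>i. i < v \<Longrightarrow> s i = t i"
  shows "ksubst s x = ksubst t x"
proof -
  obtain A where A: "x = abs_kform A" "fvars A \<subseteq> {..<v}"
    using assms(1) by (auto simp: K_alg_def)
  define s' t' where "s' = (\<lambda>i. rep_kform (s i))" and "t' = (\<lambda>i. rep_kform (t i))"
  then have s': "s = (\<lambda>i. abs_kform (s' i))" and t': "t = (\<lambda>i. abs_kform (t' i))"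
    by (simp_all add: Quotient3_abs_rep[OF Quotient3_kform])
  define t'' where "t'' = (\<lambda>i. if i < v then s' i else t' i)"
  have "t = (\<lambda>i. abs_kform (t'' i))"
    using assms(2) by (auto simp: fun_eq_iff s' t' t''_def)
  moreover have "fsubst s' A = fsubst t'' A"
    using A by (intro fsubst_cong) (auto simp: t''_def)
  ultimately show ?thesis
    by (simp add: A(1) s' ksubst_abs)
qed

lemma ksubst_ksubst: "ksubst t (ksubst s x) = ksubst (\<lambda>i. ksubst t (s i)) x"
  by transfer (simp add: fsubst_fsubst K_equiv_refl K_equiv_fsubst)

lemma ksubst_kvar: "ksubst s (kvar i) = s i"
  by transfer (simp add: K_equiv_refl)

lemma ksubst_kvar_id: "ksubst kvar x = x"
  by transfer (simp add: fsubst_Var K_equiv_refl)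

lemma kvar_in_K_alg: "i < v \<Longrightarrow> kvar i \<in> K_alg v 0"
  by (auto simp: K_alg_def kvar.abs_eq)

lemma ksubst_in_K_alg:
  assumes "x \<in> K_alg v d" and "\<And>i. i < v \<Longrightarrow> s i \<in> K_alg v 0"
  shows "ksubst s x \<in> K_alg v d"
proof -
  obtain A where A: "x = abs_kform A" "fvars A \<subseteq> {..<v}" "mdeg A \<le> d"
    using assms(1) by (auto simp: K_alg_def)
  have "\<exists>B. i < v \<longrightarrow> s i = abs_kform B \<and> fvars B \<subseteq> {..<v} \<and> mdeg B = 0" for i
    using assms(2)[of i] by (auto simp: K_alg_def)
  then obtain f where f: "\<And>i. i < v \<Longrightarrow> s i = abs_kform (f i) \<and> fvars (f i) \<subseteq> {..<v} \<and> mdeg (f i) = 0"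
    by metis
  have "ksubst s x = ksubst (\<lambda>i. abs_kform (f i)) x"
    using assms(1) f by (intro ksubst_cong) auto
  also have "\<dots> = abs_kform (fsubst f A)"
    by (simp add: A(1) ksubst_abs)
  also have "\<dots> \<in> K_alg v d"
    unfolding K_alg_def
  proof (intro imageI CollectI conjI)
    show "fvars (fsubst f A) \<subseteq> {..<v}"
      using A(2) f by (fastforce simp: fvars_fsubst)
    have "mdeg (fsubst f A) = mdeg A"
      using A(2) f by (intro mdeg_fsubst) auto
    then show "mdeg (fsubst f A) \<le> d"
      using A(3) by simp
  qed
  finally show ?thesis .
qed

lemma monoid_subst0: "monoid (subst0_monoid v)"
proof
  fix s t u
  assume st: "s \<in> carrier (subst0_monoid v)" "t \<in> carrier (subst0_monoid v)"
  then show "s \<otimes>\<^bsub>subst0_monoid v\<^esub> t \<in> carrier (subst0_monoid v)"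
    by (auto simp: subst0_monoid_def PiE_iff intro!: ksubst_in_K_alg)
  have "ksubst u (ksubst t (s i)) = ksubst (\<lambda>i\<in>{..<v}. ksubst u (t i)) (s i)" if "i < v" for i
    unfolding ksubst_ksubst
    by (rule ksubst_cong[of _ v 0]) (use st that in \<open>auto simp: subst0_monoid_def PiE_iff\<close>)
  then show "s \<otimes>\<^bsub>subst0_monoid v\<^esub> t \<otimes>\<^bsub>subst0_monoid v\<^esub> u =
      s \<otimes>\<^bsub>subst0_monoid v\<^esub> (t \<otimes>\<^bsub>subst0_monoid v\<^esub> u)"
    by (auto simp: subst0_monoid_def fun_eq_iff)
next
  show "\<one>\<^bsub>subst0_monoid v\<^esub> \<in> carrier (subst0_monoid v)"
    by (auto simp: subst0_monoid_def kvar_in_K_alg)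
next
  fix s assume s: "s \<in> carrier (subst0_monoid v)"
  show "\<one>\<^bsub>subst0_monoid v\<^esub> \<otimes>\<^bsub>subst0_monoid v\<^esub> s = s"
    using s by (auto simp: subst0_monoid_def fun_eq_iff ksubst_kvar PiE_iff extensional_def)
  have "ksubst (\<lambda>i\<in>{..<v}. kvar i) (s i) = s i" if "i < v" for i
    using ksubst_cong[of "s i" v 0 "\<lambda>i\<in>{..<v}. kvar i" kvar] s that
    by (auto simp: subst0_monoid_def PiE_iff ksubst_kvar_id)
  then show "s \<otimes>\<^bsub>subst0_monoid v\<^esub> \<one>\<^bsub>subst0_monoid v\<^esub> = s"
    using s by (auto simp: subst0_monoid_def fun_eq_iff PiE_iff extensional_def)
qed

lemma group_prime_substs: "group (prime_substs v)"
  unfolding prime_substs_def by (rule monoid.units_group[OF monoid_subst0])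

lemma ksubst_mult:
  "x \<in> K_alg v d \<Longrightarrow> ksubst (s \<otimes>\<^bsub>prime_substs v\<^esub> t) x = ksubst t (ksubst s x)"
  unfolding ksubst_ksubst
  by (rule ksubst_cong) (auto simp: prime_substs_def units_of_def subst0_monoid_def)

end

theory Submission
  imports Defs
begin

text \<open>
  A prime substitution \<open>\<tau>\<close> acts on \<open>K[v,d]\<close> as an automorphism of ordered sets. If \<open>\<mu>\<close> and
  \<open>\<nu>\<close> lie in the same orbit, with \<open>\<mu>\<close> below \<open>\<phi>\<close> and \<open>\<nu>\<close> not, choose \<open>\<tau>\<close> with
  \<open>\<mu> = \<nu> \<circ> \<tau>\<close>. Then \<open>\<mu>\<close> is not below \<open>\<phi> \<circ> \<tau>\<close>, as applying the inverse of \<open>\<tau>\<close> shows.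
  That orbits consist of minterms holds at level 0 because minterms are exactly
  the atoms of \<open>K[v,0]\<close>, and it carries over to higher levels since \<open>\<tau>\<close> commutes with
  \<open>\<diamond>\<close> and permutes the minterms one level below.
\<close>

text \<open>The order is provable implication, so closure of \<open>K_thm\<close> under
  \<open>Subst\<close> suffices.\<close>

lemma ksubst_mono: "x \<le> y \<Longrightarrow> ksubst s x \<le> ksubst s y"
  by transfer (metis K_thm.Subst fsubst.simps(3))

lemma ksubst_top: "ksubst s top_class.top = top_class.top"
  by transfer (simp add: K_equiv_refl)

lemma ksubst_bot: "ksubst s bot = bot"
  by transfer (simp add: K_equiv_refl)

lemma ksubst_inf: "ksubst s (inf x y) = inf (ksubst s x) (ksubst s y)"
  by transfer (simp add: K_equiv_refl)

lemma ksubst_uminus: "ksubst s (- x) = - ksubst s x"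
  by transfer (simp add: K_equiv_refl)

lemma ksubst_kdia: "ksubst s (kdia x) = kdia (ksubst s x)"
  by transfer (simp add: K_equiv_refl)

lemma meet_empty: "meet {} = top_class.top"
  by (simp add: meet_def)

text \<open>Idempotence of \<open>inf\<close> covers the case where \<open>x\<close> already belongs
  to \<open>X\<close>.\<close>

lemma meet_insert: "finite X \<Longrightarrow> meet (insert x X) = inf x (meet X)"
  unfolding meet_def
  by (rule comp_fun_idem_on.fold_insert_idem[OF comp_fun_idem_inf[unfolded comp_fun_idem_def']]) auto

lemma le_meet_iff: "finite X \<Longrightarrow> a \<le> meet X \<longleftrightarrow> (\<forall>x\<in>X. a \<le> x)"
  by (induction X rule: finite_induct) (auto simp: meet_empty meet_insert)

lemma ksubst_meet: "finite X \<Longrightarrow> ksubst s (meet X) = meet (ksubst s ` X)"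
  by (induction X rule: finite_induct) (auto simp: meet_empty meet_insert ksubst_top ksubst_inf)

lemma K_alg_mono: "d \<le> e \<Longrightarrow> K_alg v d \<subseteq> K_alg v e"
  by (auto simp: K_alg_def)

lemma top_in_K_alg: "top_class.top \<in> K_alg v d"
  unfolding K_alg_def top_kform.abs_eq by (intro imageI) simp

lemma inf_in_K_alg: "x \<in> K_alg v d \<Longrightarrow> y \<in> K_alg v d \<Longrightarrow> inf x y \<in> K_alg v d"
  unfolding K_alg_def by (auto simp: inf_kform.abs_eq intro!: imageI)

lemma uminus_in_K_alg: "x \<in> K_alg v d \<Longrightarrow> - x \<in> K_alg v d"
  unfolding K_alg_def by (auto simp: uminus_kform.abs_eq intro!: imageI)

lemma kdia_in_K_alg: "x \<in> K_alg v d \<Longrightarrow> kdia x \<in> K_alg v (Suc d)"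
  unfolding K_alg_def by (auto simp: kdia.abs_eq intro!: imageI)

lemma meet_in_K_alg: "finite X \<Longrightarrow> X \<subseteq> K_alg v d \<Longrightarrow> meet X \<in> K_alg v d"
  by (induction X rule: finite_induct) (auto simp: meet_empty meet_insert top_in_K_alg inf_in_K_alg)

lemma finite_minterms0: "finite (minterms0 v)"
  unfolding minterms0_def by simp

lemma finite_minterms: "finite (minterms v d)"
proof (induction d)
  case (Suc d)
  have "minterms v (Suc d) = (\<lambda>(m, T). inf m (meet ((\<lambda>\<mu>. if \<mu> \<in> T then kdia \<mu> else - kdia \<mu>) ` minterms v d)))
      ` (minterms0 v \<times> Pow (minterms v d))"
    by auto
  then show ?case
    using Suc finite_minterms0 by simp
qed (simp add: finite_minterms0)

lemma minterms0_subset_K_alg: "minterms0 v \<subseteq> K_alg v 0"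
  unfolding minterms0_def
  by (auto intro!: meet_in_K_alg simp: kvar_in_K_alg uminus_in_K_alg)

lemma minterms_subset_K_alg: "minterms v d \<subseteq> K_alg v d"
proof (induction d)
  case (Suc d)
  have "minterms0 v \<subseteq> K_alg v (Suc d)"
    using minterms0_subset_K_alg K_alg_mono[of 0 "Suc d" v] by blast
  then show ?case
    using Suc by (auto intro!: inf_in_K_alg meet_in_K_alg uminus_in_K_alg kdia_in_K_alg
        simp: finite_minterms)
qed (simp add: minterms0_subset_K_alg)

text \<open>The signs of \<open>m\<close> decide every variable below \<open>v\<close>; being
  decided passes through \<open>Fls\<close> and \<open>Imp\<close>, and degree 0 excludes
  \<open>Box\<close>.\<close>

lemma minterm0_decides:
  assumes "m \<in> minterms0 v" "y \<in> K_alg v 0"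
  shows "m \<le> y \<or> m \<le> - y"
proof -
  obtain S where m: "m = meet ((\<lambda>i. if i \<in> S then kvar i else - kvar i) ` {..<v})"
    using assms(1) by (auto simp: minterms0_def)
  have lit: "m \<le> (if i \<in> S then kvar i else - kvar i)" if "i < v" for i
    using le_meet_iff[of "(\<lambda>i. if i \<in> S then kvar i else - kvar i) ` {..<v}" m] that
    by (simp add: m)
  have "fvars A \<subseteq> {..<v} \<Longrightarrow> mdeg A = 0 \<Longrightarrow> m \<le> abs_kform A \<or> m \<le> - abs_kform A" for A
  proof (induction A)
    case (Var i)
    then show ?case
      using lit[of i] by (auto simp: kvar.abs_eq split: if_splits)
  next
    case Fls
    then show ?case
      by (simp flip: bot_kform.abs_eq)
  next
    case (Imp A B)
    have "abs_kform (Imp A B) = sup (- abs_kform A) (abs_kform B)"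
      by (auto simp: sup_kform.abs_eq uminus_kform.abs_eq kform.abs_eq_iff K_equiv_def tautology_def
          intro!: K_thm.taut)
    then show ?case
      using Imp by (auto intro: le_supI1 le_supI2)
  qed simp
  then show ?thesis
    using assms(2) by (auto simp: K_alg_def)
qed

text \<open>The verdicts of \<open>a\<close> on the variables are the signs of a minterm above
  \<open>a\<close>, and this minterm in turn decides \<open>a\<close>.\<close>

lemma atom_in_minterms0:
  assumes a: "a \<in> K_alg v 0" "a \<noteq> bot"
    and decides: "\<And>y. y \<in> K_alg v 0 \<Longrightarrow> a \<le> y \<or> a \<le> - y"
  shows "a \<in> minterms0 v"
proof -
  define S where "S = {i. i < v \<and> a \<le> kvar i}"
  define m where "m = meet ((\<lambda>i. if i \<in> S then kvar i else - kvar i) ` {..<v})"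
  have m: "m \<in> minterms0 v"
    unfolding m_def minterms0_def S_def by blast
  have "a \<le> m"
    using decides[OF kvar_in_K_alg] by (auto simp: m_def le_meet_iff S_def)
  \<comment> \<open>Otherwise \<open>a\<close> would lie below its own complement.\<close>
  moreover have "\<not> m \<le> - a"
    using \<open>a \<le> m\<close> a(2) by (metis inf.absorb1 inf_compl_bot order.trans)
  ultimately have "m = a"
    using minterm0_decides[OF m a(1)] by simp
  then show ?thesis
    using m by simp
qed

lemma prime_subst_in_K_alg:
  assumes "s \<in> carrier (prime_substs v)" "x \<in> K_alg v d"
  shows "ksubst s x \<in> K_alg v d"
  using assms
  by (intro ksubst_in_K_alg) (auto simp: prime_substs_def units_of_def Units_def subst0_monoid_def)

lemma ksubst_one:
  assumes "x \<in> K_alg v d"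
  shows "ksubst \<one>\<^bsub>prime_substs v\<^esub> x = x"
proof -
  \<comment> \<open>The unit is unspecified outside \<open>{..<v}\<close>, so it agrees with
    \<open>kvar\<close> only on the variables that occur in elements of
    \<open>K_alg v d\<close>.\<close>
  have "ksubst \<one>\<^bsub>prime_substs v\<^esub> x = ksubst kvar x"
    using assms by (rule ksubst_cong) (simp add: prime_substs_def units_of_def subst0_monoid_def)
  then show ?thesis
    by (simp add: ksubst_kvar_id)
qed

text \<open>The action is on the right, so this composite is the action of \<open>s\<close> times
  its inverse; hence \<open>r_inv\<close>.\<close>

lemma ksubst_inv_ksubst:
  assumes "s \<in> carrier (prime_substs v)" "x \<in> K_alg v d"
  shows "ksubst (inv\<^bsub>prime_substs v\<^esub> s) (ksubst s x) = x"
  using ksubst_mult[OF assms(2), of s] ksubst_one[OF assms(2)] assms(1)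
  by (metis group.r_inv[OF group_prime_substs])

lemma ksubst_ksubst_inv:
  assumes "s \<in> carrier (prime_substs v)" "x \<in> K_alg v d"
  shows "ksubst s (ksubst (inv\<^bsub>prime_substs v\<^esub> s) x) = x"
  using ksubst_mult[OF assms(2), of _ s] ksubst_one[OF assms(2)] assms(1)
  by (metis group.l_inv[OF group_prime_substs])

text \<open>The verdict of the image on \<open>y\<close> is transported from the verdict of
  \<open>m\<close> on the image of \<open>y\<close> under the inverse.\<close>

lemma ksubst_minterms0:
  assumes s: "s \<in> carrier (prime_substs v)" and m: "m \<in> minterms0 v"
  shows "ksubst s m \<in> minterms0 v"
proof (cases "ksubst s m = bot")
  \<comment> \<open>This case replaces a proof that minterms are consistent: \<open>s\<close> is
    injective on \<open>K_alg v 0\<close> and fixes \<open>bot\<close>, so \<open>m\<close> is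
    \<open>bot\<close> and its own image.\<close>
  case True
  then have "m = bot"
    using ksubst_inv_ksubst[OF s, of m 0] m minterms0_subset_K_alg ksubst_bot by fastforce
  then show ?thesis
    using m ksubst_bot by simp
next
  case False
  let ?t = "inv\<^bsub>prime_substs v\<^esub> s"
  have t: "?t \<in> carrier (prime_substs v)"
    using s by (rule group.inv_closed[OF group_prime_substs])
  show ?thesis
  proof (rule atom_in_minterms0[OF _ False])
    show "ksubst s m \<in> K_alg v 0"
      using s m minterms0_subset_K_alg prime_subst_in_K_alg by blast
  next
    fix y assume y: "y \<in> K_alg v 0"
    have "m \<le> ksubst ?t y \<or> m \<le> - ksubst ?t y"
      using m prime_subst_in_K_alg[OF t y] by (rule minterm0_decides)
    then show "ksubst s m \<le> y \<or> ksubst s m \<le> - y"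
      using ksubst_mono[of m _ s] ksubst_ksubst_inv[OF s y] by (metis ksubst_uminus)
  qed
qed

lemma ksubst_minterms:
  assumes s: "s \<in> carrier (prime_substs v)" and "\<mu> \<in> minterms v d"
  shows "ksubst s \<mu> \<in> minterms v d"
  using assms
proof (induction d arbitrary: s \<mu>)
  case 0
  then show ?case
    by (simp add: ksubst_minterms0)
next
  case (Suc d)
  let ?M = "minterms v d" and ?t = "inv\<^bsub>prime_substs v\<^esub> s"
  let ?sgn = "\<lambda>T \<mu>. if \<mu> \<in> T then kdia \<mu> else - kdia \<mu>"
  obtain m T where mT: "\<mu> = inf m (meet (?sgn T ` ?M))" "m \<in> minterms0 v" "T \<subseteq> ?M"
    using Suc.prems(2) by auto
  have t: "?t \<in> carrier (prime_substs v)"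
    using Suc.prems(1) by (rule group.inv_closed[OF group_prime_substs])
  have inv: "ksubst ?t (ksubst s \<nu>) = \<nu>" "ksubst s (ksubst ?t \<nu>) = \<nu>" if "\<nu> \<in> ?M" for \<nu>
    using that minterms_subset_K_alg ksubst_inv_ksubst[OF Suc.prems(1)]
      ksubst_ksubst_inv[OF Suc.prems(1)] by blast+
  \<comment> \<open>Surjectivity applies the induction hypothesis to the inverse, which is why
    \<open>s\<close> is arbitrary in the induction.\<close>
  have perm: "ksubst s ` ?M = ?M"
  proof
    show "ksubst s ` ?M \<subseteq> ?M"
      using Suc.IH[OF Suc.prems(1)] by blast
    show "?M \<subseteq> ksubst s ` ?M"
      using Suc.IH[OF t] inv(2) by (metis image_iff subsetI)
  qed
  \<comment> \<open>Injectivity of \<open>s\<close> on the minterms ensures that each literal keeps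
    its sign when \<open>T\<close> is replaced by its image.\<close>
  have mem: "ksubst s \<nu> \<in> ksubst s ` T \<longleftrightarrow> \<nu> \<in> T" if "\<nu> \<in> ?M" for \<nu>
    using that mT(3) inv(1) by (metis (no_types, lifting) image_iff subsetD)
  have "ksubst s ` ?sgn T ` ?M = ?sgn (ksubst s ` T) ` ksubst s ` ?M"
    unfolding image_image using mem
    by (intro image_cong) (auto simp: ksubst_kdia ksubst_uminus)
  then have "ksubst s \<mu> = inf (ksubst s m) (meet (?sgn (ksubst s ` T) ` ?M))"
    by (simp add: mT(1) ksubst_inf ksubst_meet finite_minterms perm)
  moreover have "ksubst s m \<in> minterms0 v"
    using Suc.prems(1) mT(2) by (rule ksubst_minterms0)
  moreover have "ksubst s ` T \<subseteq> ?M"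
    using mT(3) perm by blast
  ultimately show ?case
    by auto
qed

theorem theorem5:
  fixes v d :: nat and \<phi> :: kform and \<omega> :: "kform set"
  assumes "\<phi> \<in> K_alg v d"
    and "\<omega> \<in> prime_orbits v d"
    and "minterms_of v d \<phi> \<inter> \<omega> \<noteq> {}"
    and "minterms_of v d \<phi> \<inter> \<omega> \<subset> \<omega>"
  shows "\<exists>\<sigma> \<in> carrier (prime_substs v).
    minterms_of v d (inf \<phi> (ksubst \<sigma> \<phi>)) \<subset> minterms_of v d \<phi>"
proof -
  let ?G = "prime_substs v"
  obtain x where x: "x \<in> minterms v d" and \<omega>: "\<omega> = {ksubst g x | g. g \<in> carrier ?G}"
    using assms(2) by (auto simp: prime_orbits_def orbits_def orbit_def)
  obtain h where h: "h \<in> carrier ?G" and \<mu>: "ksubst h x \<in> minterms_of v d \<phi>"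
    using assms(3) \<omega> by blast
  obtain g where g: "g \<in> carrier ?G" and "ksubst g x \<notin> minterms_of v d \<phi>"
    using assms(4) \<omega> by blast
  \<comment> \<open>The whole orbit consists of minterms, so missing
    \<open>minterms_of v d \<phi>\<close> can only mean failing the inequality.\<close>
  then have \<nu>: "\<not> ksubst g x \<le> \<phi>"
    using ksubst_minterms[OF g x] by (simp add: minterms_of_def)
  have xK: "x \<in> K_alg v d"
    using x minterms_subset_K_alg by blast
  \<comment> \<open>In a right action the left factor acts first: the inverse of \<open>g\<close>
    returns \<open>ksubst g x\<close> to \<open>x\<close>, and \<open>h\<close> then moves
    \<open>x\<close> below \<open>\<phi>\<close>.\<close>
  define \<tau> where "\<tau> = inv\<^bsub>?G\<^esub> g \<otimes>\<^bsub>?G\<^esub> h"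
  have \<tau>: "\<tau> \<in> carrier ?G"
    unfolding \<tau>_def using g h group_prime_substs[of v]
    by (simp add: group.is_monoid monoid.m_closed group.inv_closed)
  have "ksubst \<tau> (ksubst g x) = ksubst h x"
    unfolding \<tau>_def using ksubst_mult[OF prime_subst_in_K_alg[OF g xK]] ksubst_inv_ksubst[OF g xK]
    by simp
  \<comment> \<open>Applying the inverse of \<open>\<tau>\<close> to the inequality would give
    \<open>ksubst g x \<le> \<phi>\<close>.\<close>
  then have "\<not> ksubst h x \<le> ksubst \<tau> \<phi>"
    using \<nu> ksubst_mono[of "ksubst h x" "ksubst \<tau> \<phi>" "inv\<^bsub>?G\<^esub> \<tau>"]
      ksubst_inv_ksubst[OF \<tau> assms(1)] ksubst_inv_ksubst[OF \<tau> prime_subst_in_K_alg[OF g xK]]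
    by auto
  \<comment> \<open>The minterm \<open>ksubst h x\<close> witnesses strictness.\<close>
  then have "minterms_of v d (inf \<phi> (ksubst \<tau> \<phi>)) \<subset> minterms_of v d \<phi>"
    using \<mu> by (auto simp: minterms_of_def)
  then show ?thesis
    using \<tau> by blast
qed

end
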